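(* Let $m\ge 2$ be an integer, let $a_1,\ldots,a_{m-1}$ be positive integers (not necessarily distinct), and let $S=\sum_{i=1}^{m-1}a_i$. Let $c$ be an integer with $c>S-1$ and $cS$ even. Write $\mathrm{Rad}_2(c)$ for $\mathrm{Rad}_2(a_1,\ldots,a_{m-1},-1;c)$. (i) $$\mathrm{Rad}_2(c)\ge\left\lceil\frac{1+c(S+2)}{S^2+S-1}\right\rceil.$$ (ii) If the multiset $\{a_1,\ldots,a_{m-1}\}$ is $2$-distributable and $c>S(S-1)$, then $$\mathrm{Rad}_2(c)=\left\lceil\frac{1+c(S+2)}{S^2+S-1}\right\rceil.$$
   Context: For nonzero integers $b_1,\ldots,b_m$, an integer $c$ and an integer $r\ge 2$, the Rado number $\mathrm{Rad}_r(b_1,\ldots,b_m;c)$ is the least positive integer $N$ such that for every colouring $\chi:\{1,\ldots,N\}\to\{1,\ldots,r\}$ there exist $x_1,\ldots,x_m\in\{1,\ldots,N\}$ (not necessarily distinct) with $\sum_{i=1}^m b_ix_i=c$ and $\chi(x_1)=\cdots=\chi(x_m)$. Thus $\mathrm{Rad}_2(a_1,\ldots,a_{m-1},-1;c)$ refers to the equation $\sum_{i=1}^{m-1}a_ix_i-x_m=c$. If no such $N$ exists, the Rado number does not exist and is regarded as $\infty$ in inequalities; an equality with a finite number includes the assertion that it exists. A multiset $\{a_1,\ldots,a_k\}$ of positive integers is $t$-distributable ($t$ a positive integer) if for every choice of nonnegative integers $\sigma_1,\ldots,\sigma_t$ with $\sum_{j=1}^t\sigma_j=\sum_{i=1}^k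 a_i$ there is a partition of the index set $\{1,\ldots,k\}$ into pairwise disjoint sets $S_1,\ldots,S_t$ (some possibly empty) such that $\sum_{i\in S_j}a_i=\sigma_j$ for every $j\in\{1,\ldots,t\}$.
   Formalization: In part (ii) the single case m = 2, a_1 = 1 is excluded: there the equation is x_1 - x_2 = c, and colouring x by the parity of floor(x/c) avoids all monochromatic solutions, so the Rado number is infinite and the printed equality fails. *)

theory Defs
  imports Complex_Main "HOL-Library.Extended_Nat" "HOL-Library.FuncSet" "HOL-Library.Disjoint_Sets"
begin

text \<open>An equation is given by the list \<open>b\<close> of its coefficients and its right-hand side \<open>c\<close>.
  Lists are indexed from 0, so the variable \<open>x\<^sub>i\<close> of the usual notation is \<open>x (i - 1)\<close> here.\<close>

definition mono_solution :: "(nat \<Rightarrow> nat) \<Rightarrow> int list \<Rightarrow> int \<Rightarrow> nat \<Rightarrow> (nat \<Rightarrow> nat) \<Rightarrow> bool" where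
  "mono_solution \<chi> b c N x \<longleftrightarrow>
     (\<forall>i<length b. x i \<in> {1..N}) \<and>
     (\<Sum>i<length b. b ! i * int (x i)) = c \<and>
     (\<forall>i<length b. \<forall>j<length b. \<chi> (x i) = \<chi> (x j))"

definition rado_forced :: "nat \<Rightarrow> int list \<Rightarrow> int \<Rightarrow> nat \<Rightarrow> bool" where
  "rado_forced r b c N \<longleftrightarrow>
     (\<forall>\<chi> \<in> {1..N} \<rightarrow> {1..r}. \<exists>x. mono_solution \<chi> b c N x)"

definition rado :: "nat \<Rightarrow> int list \<Rightarrow> int \<Rightarrow> enat" where
  "rado r b c =
     (if \<exists>N>0. rado_forced r b c N then enat (LEAST N. N > 0 \<and> rado_forced r b c N) else \<infinity>)"

text \<open>A list stands for the multiset of its entries, together with the indexing of the entries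
  that the partition in the definition refers to.\<close>

definition distributable :: "nat \<Rightarrow> nat list \<Rightarrow> bool" where
  "distributable t a \<longleftrightarrow>
     (\<forall>\<sigma> :: nat \<Rightarrow> nat. (\<Sum>j\<in>{1..t}. \<sigma> j) = (\<Sum>i<length a. a ! i) \<longrightarrow>
        (\<exists>P :: nat \<Rightarrow> nat set.
           disjoint_family_on P {1..t} \<and>
           (\<Union>j\<in>{1..t}. P j) = {..<length a} \<and>
           (\<forall>j\<in>{1..t}. (\<Sum>i\<in>P j. a ! i) = \<sigma> j)))"

end

theory Submission
  imports Defs
begin

text \<open>The key step is to measure every variable from the top of the interval: with \<open>x = N - u\<close>, a
  solution in \<open>{1..N}\<close> of the equation becomes a solution in \<open>{0..N - 1}\<close> of
  \[ u_m = \sum_i a_i u_i + k, \qquad k = c - (S - 1) N, \]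
  which has the shape of Schur's equation with an additive constant. Moreover
  \<open>N \<le> (S + 2) k\<close> is the same as \<open>N (S\<^sup>2 + S - 1) \<le> c (S + 2)\<close>, so the bound of the theorem
  is the least \<open>N\<close> with \<open>N > (S + 2) k\<close>.

  If \<open>N \<le> (S + 2) k\<close>, colour the block \<open>k \<le> u < (S + 1) k\<close> with one colour and its complement
  with the other. Within the block the right-hand side is at least \<open>S k + k\<close>, so it leaves the block.
  In the complement, either all \<open>u\<^sub>i < k\<close>, and the right-hand side lands in the block, or some
  \<open>u\<^sub>i \<ge> (S + 1) k\<close>, and the right-hand side is at least \<open>(S + 2) k\<close>, hence too large
  (lemma \<open>block_colouring_avoids_solutions\<close>).

  For the upper bound, solutions in which \<open>u\<^sub>1, \<dots>, u\<^sub>m\<^sub>-\<^sub>1\<close> take at most two values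
  suffice. By 2-distributability the total weight of the second value may be any number in \<open>{0..S}\<close>,
  so the question is about the equation \<open>r = (S - s) p + s q + k\<close> alone. A short forcing argument along
  the multiples of \<open>k\<close>, or of \<open>k / 2\<close> when \<open>S\<close> is odd, treats \<open>k > 0\<close>
  (lemma \<open>not_avoids_two_valued_pos\<close>). For small \<open>c\<close> the constant \<open>k\<close> can be
  negative at the threshold; minimality of \<open>N\<close> then gives \<open>-k < S - 1\<close>, the assumption
  \<open>c > S (S - 1)\<close> gives \<open>N > S\<close>, and a forcing argument inside \<open>{0..S}\<close> works
  (lemma \<open>not_avoids_two_valued_neg\<close>). The evenness of \<open>c S\<close> enters as evenness of \<open>k\<close>
  for odd \<open>S\<close>.\<close>

section \<open>Reversing the interval\<close>

text \<open>The substitution \<open>x = N - u\<close> described above. It is valid for all integers, so that the range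
  condition on the variables can be handled separately.\<close>

lemma equation_reversed:
  fixes x :: "nat \<Rightarrow> nat" and N :: int
  assumes "S = (\<Sum>i<length a. int (a ! i))"
  shows "(\<Sum>i<length (map int a @ [- 1]). (map int a @ [- 1]) ! i * int (x i)) = c \<longleftrightarrow>
     N - int (x (length a)) =
       (\<Sum>i<length a. int (a ! i) * (N - int (x i))) + (c - (S - 1) * N)"
proof -
  have "(\<Sum>i<length (map int a @ [- 1]). (map int a @ [- 1]) ! i * int (x i))
      = (\<Sum>i<length a. int (a ! i) * int (x i)) - int (x (length a))"
    by (simp add: nth_append)
  moreover have "(\<Sum>i<length a. int (a ! i) * (N - int (x i)))
      = S * N - (\<Sum>i<length a. int (a ! i) * int (x i))"
    unfolding assms by (simp add: right_diff_distrib sum_subtractf sum_distrib_right)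
  ultimately show ?thesis by (auto simp: algebra_simps)
qed

section \<open>The lower bound\<close>

text \<open>The extremal colouring, for \<open>N \<le> (S + 2) k\<close>: the upper end of the interval is a block of
  length \<open>k\<close> in colour 1, followed downwards by a block of length \<open>S k\<close> in colour 2, and
  the rest has colour 1 again.\<close>

lemma block_colouring_avoids_solutions:
  fixes S c :: int
  assumes S: "S = (\<Sum>i<length a. int (a ! i))"
    and pos: "\<forall>i<length a. a ! i > 0" and "a \<noteq> []"
    and N: "int N \<le> (S + 2) * (c - (S - 1) * int N)" "N > 0"
  shows "\<not> rado_forced 2 (map int a @ [- 1]) c N"
proof
  assume forced: "rado_forced 2 (map int a @ [- 1]) c N"
  define k where "k = c - (S - 1) * int N"
  define L where "L = length a"
  have S1: "S \<ge> 1"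
  proof -
    have "(\<Sum>i<length a. int (a ! i)) > 0"
      using pos \<open>a \<noteq> []\<close> by (intro sum_pos) auto
    then show ?thesis using S by simp
  qed
  have Nk: "int N \<le> (S + 2) * k" using N(1) by (simp add: k_def)
  have k1: "k \<ge> 1"
  proof (rule ccontr)
    assume "\<not> k \<ge> 1"
    then have "(S + 2) * k \<le> 0" using S1 by (simp add: mult_nonneg_nonpos)
    then show False using Nk \<open>N > 0\<close> by simp
  qed
  define \<chi> :: "nat \<Rightarrow> nat" where
    "\<chi> = (\<lambda>x. if k \<le> int N - int x \<and> int N - int x < (S + 1) * k then 2 else 1)"
  have "\<chi> \<in> {1..N} \<rightarrow> {1..2}" by (auto simp: \<chi>_def)
  then obtain x where x: "mono_solution \<chi> (map int a @ [- 1]) c N x"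
    using forced unfolding rado_forced_def by blast
  define u where "u = (\<lambda>i. int N - int (x i))"
  have len: "length (map int a @ [- 1]) = Suc L" by (simp add: L_def)
  have range: "0 \<le> u i" "u i < int N" if "i \<le> L" for i
  proof -
    have "\<forall>i<Suc L. x i \<in> {1..N}"
      using x unfolding mono_solution_def len by blast
    moreover have "i < Suc L" using that by simp
    ultimately have "x i \<in> {1..N}" by blast
    then show "0 \<le> u i" "u i < int N" by (auto simp: u_def)
  qed
  have col: "\<chi> (x i) = \<chi> (x L)" if "i \<le> L" for i
  proof -
    have "\<forall>i<Suc L. \<forall>j<Suc L. \<chi> (x i) = \<chi> (x j)"
      using x unfolding mono_solution_def len by blast
    moreover have "i < Suc L" "L < Suc L" using that by simp_all
    ultimately show ?thesis by blast
  qed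
  have eq: "u L = (\<Sum>i<L. int (a ! i) * u i) + k"
    using x equation_reversed[OF S, of x c "int N"] unfolding mono_solution_def u_def L_def k_def by blast
  have bound: "(\<Sum>i<L. int (a ! i) * t) = S * t" for t
    unfolding S L_def by (simp add: sum_distrib_right)
  have uL: "u L \<ge> k" unfolding eq using range(1)
    by (auto intro!: sum_nonneg mult_nonneg_nonneg)
  have block: "\<chi> (x i) = (if k \<le> u i \<and> u i < (S + 1) * k then 2 else 1)" for i
    by (simp add: \<chi>_def u_def)
  show False
  proof (cases "u L < (S + 1) * k")
    case True
    then have "k \<le> u i" if "i < L" for i
      using col[of i] that uL unfolding block by (auto split: if_splits)
    then have "(\<Sum>i<L. int (a ! i) * k) \<le> (\<Sum>i<L. int (a ! i) * u i)"
      by (intro sum_mono mult_left_mono) auto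
    then show False using True eq bound[of k] by (simp add: algebra_simps)
  next
    case False
    then have outside: "u i < k \<or> u i \<ge> (S + 1) * k" if "i < L" for i
      using col[of i] that unfolding block by (auto split: if_splits)
    show False
    proof (cases "\<forall>i<L. u i < k")
      case True
      then have "(\<Sum>i<L. int (a ! i) * u i) \<le> (\<Sum>i<L. int (a ! i) * (k - 1))"
        by (intro sum_mono mult_left_mono) auto
      then show False using False eq bound[of "k - 1"] S1 by (simp add: algebra_simps)
    next
      case False
      then obtain i where i: "i < L" "u i \<ge> (S + 1) * k" using outside by auto
      have "1 * u i \<le> int (a ! i) * u i"
        using pos i(1) range[of i] by (intro mult_right_mono) (auto simp: L_def Suc_le_eq)
      also have "\<dots> \<le> (\<Sum>i<L. int (a ! i) * u i)"
        using i(1) range by (intro member_le_sum) auto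
      finally have "u L \<ge> (S + 2) * k" using eq i(2) by (simp add: algebra_simps)
      then show False using range[of L] Nk by simp
    qed
  qed
qed

section \<open>Two-valued solutions\<close>

text \<open>This is the part of the reversed equation that 2-distributability gives access to: \<open>p\<close> is the
  value of the variables of total weight \<open>S - s\<close> and \<open>q\<close> that of the variables of total
  weight \<open>s\<close>.\<close>

definition avoids_two_valued :: "(int \<Rightarrow> bool) \<Rightarrow> int \<Rightarrow> int \<Rightarrow> int \<Rightarrow> bool" where
  "avoids_two_valued C S k n \<longleftrightarrow>
     (\<forall>p\<in>{0..n}. \<forall>q\<in>{0..n}. \<forall>r\<in>{0..n}. \<forall>s\<in>{0..S}.
        r = (S - s) * p + s * q + k \<longrightarrow> \<not> ((C p \<longleftrightarrow> C q) \<and> (C q \<longleftrightarrow> C r)))"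

lemma avoids_two_valuedD:
  assumes "avoids_two_valued C S k n" "r = (S - s) * p + s * q + k"
    "0 \<le> p" "p \<le> n" "0 \<le> q" "q \<le> n" "0 \<le> r" "r \<le> n" "0 \<le> s" "s \<le> S"
    "C p \<longleftrightarrow> C q"
  shows "C r \<longleftrightarrow> \<not> C p"
proof -
  have "p \<in> {0..n}" "q \<in> {0..n}" "r \<in> {0..n}" "s \<in> {0..S}" using assms by simp_all
  then have "\<not> ((C p \<longleftrightarrow> C q) \<and> (C q \<longleftrightarrow> C r))"
    using assms(1,2) unfolding avoids_two_valued_def by blast
  then show ?thesis using assms(11) by blast
qed

text \<open>Write \<open>A\<close> for the colour of 0 and \<open>B\<close> for the other colour. The multiples of \<open>k\<close>
  are forced: \<open>k\<close> is \<open>B\<close>, \<open>(S + 1) k\<close> is \<open>A\<close>, \<open>(S + 2) k\<close> is \<open>B\<close>, and \<open>2 k\<close> is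
  \<open>A\<close>. For even \<open>S\<close> this is contradictory, since \<open>(S + 1) k = (S / 2) (2 k) + k\<close>. For odd
  \<open>S\<close> the midpoints of consecutive multiples of \<open>k\<close> are integers, and the argument continues
  in units of \<open>j = k / 2\<close>.\<close>

lemma not_avoids_two_valued_pos:
  fixes S k n :: int
  assumes "S \<ge> 2" "k > 0" "n \<ge> (S + 2) * k" "odd S \<Longrightarrow> even k"
  shows "\<not> avoids_two_valued C S k n"
proof
  assume H: "avoids_two_valued C S k n"
  note D = avoids_two_valuedD[OF H]
  have le: "t * k \<le> n" if "t \<le> S + 2" for t
    using mult_right_mono[OF that, of k] assms by linarith
  have 1: "C k \<longleftrightarrow> \<not> C 0"
    using D[of k 0 0 0] assms le[of 1] le[of 0] by simp
  have 2: "C ((S + 1) * k) \<longleftrightarrow> \<not> C k"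
    using D[of "(S + 1) * k" 0 k k] assms le[of 1] le[of "S + 1"] by (simp add: algebra_simps)
  have 3: "C ((S + 2) * k) \<longleftrightarrow> \<not> C 0"
    using D[of "(S + 2) * k" 1 0 "(S + 1) * k"] 1 2 assms le[of 0] le[of "S + 1"] le[of "S + 2"]
    by (simp add: algebra_simps)
  have 4: "C (2 * k) \<longleftrightarrow> C 0"
    using D[of "(S + 2) * k" 1 k "2 * k"] 1 3 assms le[of 1] le[of 2] le[of "S + 2"]
    by (auto simp: algebra_simps)
  show False
  proof (cases "even S")
    case True
    then obtain t where t: "S = 2 * t" by (elim evenE)
    show False
      using D[of "(S + 1) * k" t 0 "2 * k"] 1 2 4 assms le[of 0] le[of 2] le[of "S + 1"] t
      by (simp add: algebra_simps)
  next
    case False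
    then obtain j where k: "k = 2 * j" using assms(4) by blast
    have S3: "S \<ge> 3" using False \<open>S \<ge> 2\<close> by (cases "S = 2") auto
    have j: "j > 0" using k assms by simp
    have le': "t * j \<le> n" if "t \<le> 2 * S + 4" for t
      using mult_right_mono[OF that, of j] j assms(3) k by (simp add: algebra_simps)
    have 5: "C (3 * j) \<longleftrightarrow> C 0"
      using D[of "(S + 2) * k" 2 k "3 * j"] 1 3 assms le[of 1] le[of "S + 2"] le'[of 3] j k
      by (auto simp: algebra_simps)
    have 6: "C j \<longleftrightarrow> \<not> C 0"
      using D[of "3 * j" 1 0 j] 5 assms le[of 0] le'[of 3] le'[of 1] j k
      by (auto simp: algebra_simps)
    \<comment> \<open>The values \<open>j\<close> and \<open>2 j\<close> are both \<open>B\<close>, which makes the whole range from \<open>S + 2\<close> to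
      \<open>2 S + 2\<close>, in units of \<open>j\<close>, an \<open>A\<close>-interval.\<close>
    have 7: "C (t * j) \<longleftrightarrow> C 0" if "S + 2 \<le> t" "t \<le> 2 * S + 2" for t
      using D[of "t * j" "2 * S + 2 - t" k j] 1 6 that assms le[of 1] le'[of 1] le'[of t] j k
      by (auto simp: algebra_simps)
    \<comment> \<open>One of \<open>S\<close>, \<open>S + 1\<close>, \<open>S + 2\<close> is a multiple \<open>3 s\<close> of 3; the \<open>A\<close>-values 0 and \<open>3 j\<close>
      then lead to \<open>(3 s + 2) j\<close>, inside that interval.\<close>
    define s where "s = (S + 2) div 3"
    have s: "S \<le> 3 * s" "3 * s \<le> 2 * S" "0 \<le> s" "s \<le> S"
      unfolding s_def using S3 by presburger+
    have "(3 * s + 2) * j = (S - s) * 0 + s * (3 * j) + k" using k by (simp add: algebra_simps)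
    then show False
      using D[of "(3 * s + 2) * j" s 0 "3 * j"] 5 7[of "3 * s + 2"] s j
        le'[of "3 * s + 2"] le'[of 3] le[of 0] assms by auto
  qed
qed

text \<open>The same method for \<open>k = -l\<close>, with forcing inside \<open>{0..S}\<close>: again \<open>A\<close> is the colour of
  0, and the divisors of \<open>l\<close>, in particular 1, are \<open>B\<close>. Then \<open>S - l\<close> and \<open>S - 1\<close> are
  \<open>A\<close>, \<open>S\<close> is \<open>B\<close>, and \<open>2\<close> is \<open>A\<close>. The last is impossible for even \<open>l\<close>, where 2 is
  a divisor of \<open>l\<close>, and for \<open>l\<close> odd, \<open>S\<close> even it is incompatible with \<open>S - 1\<close> being
  \<open>A\<close>, because \<open>S - 1 + l\<close> is then a multiple of 2.\<close>

lemma not_avoids_two_valued_neg: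
  fixes S l n :: int
  assumes "0 < l" "l < S - 1" "n \<ge> S" "odd S \<Longrightarrow> even l"
  shows "\<not> avoids_two_valued C S (- l) n"
proof
  assume H: "avoids_two_valued C S (- l) n"
  note D = avoids_two_valuedD[OF H]
  have 1: "C 1 \<longleftrightarrow> \<not> C 0"
    using D[of 0 l 0 1] assms by auto
  have 2: "C l \<longleftrightarrow> \<not> C 0"
    using D[of 0 1 0 l] assms by auto
  have 3: "C (S - l) \<longleftrightarrow> C 0"
    using D[of "S - l" 0 1 1] 1 assms by auto
  have 4: "C (S - 1) \<longleftrightarrow> C 0"
    using D[of "S - 1" 1 1 l] 1 2 assms by auto
  have 5: "C S \<longleftrightarrow> \<not> C 0"
    using D[of "S - l" 1 0 S] 3 assms by auto
  have 6: "C 2 \<longleftrightarrow> C 0"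
    using D[of S l 1 2] 1 5 assms by auto
  show False
  proof (cases "even l")
    case True
    then obtain t where "l = 2 * t" by (elim evenE)
    then show False using D[of 0 t 0 2] 6 assms by auto
  next
    case False
    then have "even (S - 1 + l)" using assms(4) by auto
    then obtain t where "S - 1 + l = 2 * t" by (elim evenE)
    then show False using D[of "S - 1" t 0 2] 4 6 assms by auto
  qed
qed

lemma distributable_2_subset:
  assumes "distributable 2 a" "s \<le> (\<Sum>i<length a. a ! i)"
  obtains P where "P \<subseteq> {..<length a}" "(\<Sum>i\<in>P. a ! i) = s"
proof -
  define \<sigma> :: "nat \<Rightarrow> nat" where
    "\<sigma> = (\<lambda>j. if j = 1 then s else (\<Sum>i<length a. a ! i) - s)"
  have 12: "{1..2} = {1, 2 :: nat}" by auto
  have "(\<Sum>j\<in>{1..2}. \<sigma> j) = (\<Sum>i<length a. a ! i)"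
    unfolding 12 using assms(2) by (simp add: \<sigma>_def)
  then obtain P where "(\<Union>j\<in>{1..2}. P j) = {..<length a}"
    "\<forall>j\<in>{1..2}. (\<Sum>i\<in>P j. a ! i) = \<sigma> j"
    using assms(1) unfolding distributable_def by metis
  then have "P 1 \<subseteq> {..<length a}" "(\<Sum>i\<in>P 1. a ! i) = s"
    by (auto simp: 12 \<sigma>_def)
  then show thesis by (rule that)
qed

lemma rado_forced_if_not_avoids_two_valued:
  fixes S c :: int
  assumes S: "S = (\<Sum>i<length a. int (a ! i))" and "distributable 2 a"
    and na: "\<And>C. \<not> avoids_two_valued C S (c - (S - 1) * int N) (int N - 1)"
  shows "rado_forced 2 (map int a @ [- 1]) c N"
  unfolding rado_forced_def
proof
  fix \<chi> :: "nat \<Rightarrow> nat" assume \<chi>: "\<chi> \<in> {1..N} \<rightarrow> {1..2}"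
  define L where "L = length a"
  define C where "C = (\<lambda>u. \<chi> (nat (int N - u)) = 1)"
  have \<chi>2: "\<chi> y = 1 \<or> \<chi> y = 2" if "y \<in> {1..N}" for y
  proof -
    have "\<chi> y \<in> {1..2}" using \<chi> that by (rule Pi_mem)
    then show ?thesis by auto
  qed
  obtain p q r s where pqr: "p \<in> {0..int N - 1}" "q \<in> {0..int N - 1}" "r \<in> {0..int N - 1}"
    and s: "s \<in> {0..S}" and eq: "r = (S - s) * p + s * q + (c - (S - 1) * int N)"
    and col: "C p \<longleftrightarrow> C q" "C q \<longleftrightarrow> C r"
    using na[of C] unfolding avoids_two_valued_def by blast
  have "nat s \<le> (\<Sum>i<length a. a ! i)" using s S by (simp add: nat_le_iff)
  then obtain P where P: "P \<subseteq> {..<length a}" "(\<Sum>i\<in>P. a ! i) = nat s"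
    using distributable_2_subset \<open>distributable 2 a\<close> by blast
  define u where "u = (\<lambda>i. if i = L then r else if i \<in> P then q else p)"
  define x where "x = (\<lambda>i. nat (int N - u i))"
  have u: "u i \<in> {0..int N - 1}" for i using pqr by (simp add: u_def)
  have xu: "int N - int (x i) = u i" for i using u[of i] by (simp add: x_def)
  have x: "x i \<in> {1..N}" for i using u[of i] by (auto simp: x_def)
  have "C (u i) \<longleftrightarrow> C p" for i using col by (simp add: u_def)
  then have "\<chi> (x i) = 1 \<longleftrightarrow> \<chi> (x j) = 1" for i j by (simp add: C_def x_def)
  then have mono: "\<chi> (x i) = \<chi> (x j)" for i j
    using \<chi>2[OF x[of i]] \<chi>2[OF x[of j]] by metis
  have sP: "(\<Sum>i\<in>P. int (a ! i)) = s" using P(2) s by (simp flip: of_nat_sum)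
  have "(\<Sum>i<L. int (a ! i) * u i) = (\<Sum>i\<in>P. int (a ! i) * q) + (\<Sum>i\<in>{..<L} - P. int (a ! i) * p)"
    using P(1) by (subst sum.subset_diff[of P]) (auto simp: u_def L_def intro!: sum.cong)
  also have "\<dots> = s * q + (S - s) * p"
    using sP S P(1) by (simp add: sum_diff L_def finite_subset flip: sum_distrib_right)
  finally have "u L = (\<Sum>i<L. int (a ! i) * u i) + (c - (S - 1) * int N)"
    using eq by (simp add: u_def)
  then have "mono_solution \<chi> (map int a @ [- 1]) c N x"
    unfolding mono_solution_def equation_reversed[OF S, of x c "int N"]
    using x mono by (simp add: xu L_def)
  then show "\<exists>x. mono_solution \<chi> (map int a @ [- 1]) c N x" by blast
qed

section \<open>The Rado number\<close>

lemma avoids_two_valued_zero: "S \<ge> 0 \<Longrightarrow> n \<ge> 0 \<Longrightarrow> \<not> avoids_two_valued C S 0 n"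
  unfolding avoids_two_valued_def by (auto intro!: bexI[of _ 0])

text \<open>The hypotheses on \<open>N\<close> say that it is the least integer above the threshold. The second of them
  is what bounds \<open>k\<close> from below when \<open>k\<close> is negative.\<close>

lemma rado_forced_at_threshold:
  fixes S c :: int
  assumes S: "S = (\<Sum>i<length a. int (a ! i))" "S \<ge> 2" and "distributable 2 a"
    and c: "c > S * (S - 1)" "even (c * S)"
    and N: "int N * (S^2 + S - 1) \<ge> 1 + c * (S + 2)"
      "(int N - 1) * (S^2 + S - 1) \<le> c * (S + 2)"
  shows "rado_forced 2 (map int a @ [- 1]) c N"
proof (rule rado_forced_if_not_avoids_two_valued[OF S(1) \<open>distributable 2 a\<close>])
  fix C
  define k where "k = c - (S - 1) * int N"
  have par: "even k" if "odd S" using that c(2) by (simp add: k_def)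
  have "\<not> avoids_two_valued C S k (int N - 1)"
  proof (cases "k > 0")
    case True
    have "int N > (S + 2) * k"
      using N(1) by (simp add: k_def algebra_simps power2_eq_square)
    then show ?thesis using True S(2) par by (intro not_avoids_two_valued_pos) auto
  next
    case False
    have "S^2 > 0" using S(2) by simp
    then have D: "S^2 + S - 1 > 0" using S(2) by linarith
    have "S * (S - 1) < (S - 1) * int N" using False c(1) by (simp add: k_def)
    then have NS: "int N > S" using S(2) by (simp add: mult.commute[of S])
    have "(S - 1) * ((int N - 1) * (S^2 + S - 1)) \<le> (S - 1) * (c * (S + 2))"
      using N(2) S(2) by (intro mult_left_mono) auto
    then have "- k * (S^2 + S - 1) \<le> (S - 1) * (S^2 + S - 1) - c"
      by (simp add: k_def algebra_simps power2_eq_square)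
    also have "\<dots> < (S - 1) * (S^2 + S - 1)" using c(1) S(2) mult_nonneg_nonneg[of S "S - 1"] by linarith
    finally have "- k < S - 1" 
      by (rule mult_right_less_imp_less) (use D in linarith)
    then show ?thesis
      using not_avoids_two_valued_neg[of "- k" S "int N - 1" C] avoids_two_valued_zero[of S "int N - 1" C]
        False NS S(2) par by (cases "k = 0") auto
  qed
  then show "\<not> avoids_two_valued C S (c - (S - 1) * int N) (int N - 1)" by (simp add: k_def)
qed

theorem theorem15:
  fixes m :: nat and a :: "nat list" and S c :: int
  assumes "m \<ge> 2"
    and "length a = m - 1"
    and "\<forall>i<m - 1. a ! i > 0"
    and "S = (\<Sum>i<m - 1. int (a ! i))"
    and "c > S - 1"
    and "even (c * S)"
  shows "rado 2 (map int a @ [- 1]) c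
           \<ge> enat (nat \<lceil>real_of_int (1 + c * (S + 2)) / real_of_int (S^2 + S - 1)\<rceil>)
         \<and> (distributable 2 a \<and> c > S * (S - 1) \<and> a \<noteq> [1] \<longrightarrow>
            rado 2 (map int a @ [- 1]) c
              = enat (nat \<lceil>real_of_int (1 + c * (S + 2)) / real_of_int (S^2 + S - 1)\<rceil>))"
proof -
  let ?b = "map int a @ [- 1]"
  define R where "R = \<lceil>real_of_int (1 + c * (S + 2)) / real_of_int (S^2 + S - 1)\<rceil>"
  have S: "S = (\<Sum>i<length a. int (a ! i))" and pos: "\<forall>i<length a. a ! i > 0" and ne: "a \<noteq> []"
    using assms by auto
  have "(\<Sum>i<length a. int (a ! i)) > 0" using pos ne by (intro sum_pos) auto
  then have S1: "S \<ge> 1" using S by simp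
  then have c1: "c \<ge> 1" using assms(5) by simp
  have "S^2 > 0" using S1 by simp
  then have D: "S^2 + S - 1 > 0" using S1 by linarith
  have R_le: "R \<le> z \<longleftrightarrow> 1 + c * (S + 2) \<le> z * (S^2 + S - 1)" for z
  proof -
    have "R \<le> z \<longleftrightarrow>
        real_of_int (1 + c * (S + 2)) \<le> real_of_int z * real_of_int (S^2 + S - 1)"
      using D unfolding R_def ceiling_le_iff by (subst pos_divide_le_eq) (simp_all only: of_int_0_less_iff)
    then show ?thesis by (simp only: flip: of_int_mult of_int_le_iff[where 'a = real])
  qed
  have R1: "R \<ge> 1" using R_le[of 0] c1 S1 mult_nonneg_nonneg[of c "S + 2"] by linarith
  have lower: "nat R \<le> N" if "N > 0" "rado_forced 2 ?b c N" for N
  proof (rule ccontr)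
    assume "\<not> nat R \<le> N"
    then have "\<not> R \<le> int N" by simp
    then have "int N \<le> (S + 2) * (c - (S - 1) * int N)"
      unfolding R_le by (simp add: algebra_simps power2_eq_square)
    then show False using block_colouring_avoids_solutions[OF S pos ne] that by blast
  qed
  have ge: "rado 2 ?b c \<ge> enat (nat R)"
    unfolding rado_def using lower LeastI_ex[of "\<lambda>N. N > 0 \<and> rado_forced 2 ?b c N"] by auto
  have eq: "rado 2 ?b c = enat (nat R)"
    if "distributable 2 a" "c > S * (S - 1)" "a \<noteq> [1]"
  proof -
    have "S \<noteq> 1"
    proof
      assume S_1: "S = 1"
      have "(\<Sum>i<length a. 1) \<le> (\<Sum>i<length a. int (a ! i))"
        using pos by (intro sum_mono) (auto simp: Suc_le_eq)
      then have "length a = 1" using ne S S_1 by (cases a) auto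
      then obtain y where "a = [y]" by (auto simp: length_Suc_conv)
      then show False using S S_1 \<open>a \<noteq> [1]\<close> by simp
    qed
    then have "rado_forced 2 ?b c (nat R)"
      using rado_forced_at_threshold[OF S _ that(1,2) assms(6), of "nat R"]
        R_le[of R] R_le[of "R - 1"] R1 S1 by simp
    then have "(LEAST N. N > 0 \<and> rado_forced 2 ?b c N) = nat R"
      using lower R1 by (intro Least_equality) auto
    moreover have "\<exists>N>0. rado_forced 2 ?b c N"
      using \<open>rado_forced 2 ?b c (nat R)\<close> R1 by (intro exI[of _ "nat R"]) simp
    ultimately show ?thesis unfolding rado_def by simp
  qed
  show ?thesis using ge eq unfolding R_def by blast
qed

end
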